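(* Let $(X,\mathcal B,\mu,T)$ be an ergodic measure-preserving dynamical system and $f\in L^2(\mu)$. Suppose that (1) $\lim_{m\to\infty}\mathbb E(f\,|\,T^{-m}\mathcal B)=0$ $\mu$-a.e. (which implies $\int f\,d\mu=0$); and (2) $\displaystyle\sum_{n=1}^\infty\frac{\|L^nf\|_2}{\sqrt n}<\infty$. Then $\{f(T^nx)\}$ is a convergence system, i.e. for every complex sequence $(a_n)_{n\ge0}$ with $\sum_n|a_n|^2<\infty$ the series $\sum_{n=0}^\infty a_nf(T^nx)$ converges for $\mu$-almost every $x$.
   Context: $(X,\mathcal B,\mu)$ is a probability space and $T:X\to X$ is measurable and preserves $\mu$. $T^{-m}\mathcal B=\{T^{-m}B: B\in\mathcal B\}$. The transfer (Perron–Frobenius) operator $L:L^1(\mu)\to L^1(\mu)$ is defined by $\int f\cdot Lg\,d\mu=\int (f\circ T)\cdot g\,d\mu$ for all $f\in L^\infty(\mu)$, $g\in L^1(\mu)$. $\|\cdot\|_2$ is the norm of $L^2(\mu)$. *)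

theory Defs
  imports "HOL-Probability.Probability"
begin

locale measure_preserving_system = prob_space M for M :: "'a measure" +
  fixes T :: "'a \<Rightarrow> 'a"
  assumes T_measurable: "T \<in> M \<rightarrow>\<^sub>M M"
    and T_preserving: "\<And>A. A \<in> sets M \<Longrightarrow> emeasure M (T -` A \<inter> space M) = emeasure M A"

locale ergodic_system = measure_preserving_system +
  assumes ergodic: "\<And>A. A \<in> sets M \<Longrightarrow> T -` A \<inter> space M = A \<Longrightarrow> prob A = 0 \<or> prob A = 1"

definition square_integrable :: "'a measure \<Rightarrow> ('a \<Rightarrow> complex) \<Rightarrow> bool" where
  "square_integrable M f \<longleftrightarrow> f \<in> borel_measurable M \<and> integrable M (\<lambda>x. (norm (f x))\<^sup>2)"

definition ess_bounded :: "'a measure \<Rightarrow> ('a \<Rightarrow> complex) \<Rightarrow> bool" where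
  "ess_bounded M f \<longleftrightarrow> f \<in> borel_measurable M \<and> (\<exists>C. AE x in M. norm (f x) \<le> C)"

definition L2_norm :: "'a measure \<Rightarrow> ('a \<Rightarrow> complex) \<Rightarrow> real" where
  "L2_norm M f = sqrt (LINT x|M. (norm (f x))\<^sup>2)"

definition pullback_algebra :: "'a measure \<Rightarrow> ('a \<Rightarrow> 'a) \<Rightarrow> nat \<Rightarrow> 'a measure" where
  "pullback_algebra M T m = vimage_algebra (space M) (T ^^ m) M"

text \<open>The library provides conditional expectations of real functions only; a complex function
  is treated componentwise (the defining properties are \<open>complex_cond_exp_measurable\<close> and
  \<open>complex_cond_exp_set_integral\<close> below).\<close>

definition complex_cond_exp :: "'a measure \<Rightarrow> 'a measure \<Rightarrow> ('a \<Rightarrow> complex) \<Rightarrow> 'a \<Rightarrow> complex" where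
  "complex_cond_exp M F f x =
     Complex (real_cond_exp M F (\<lambda>y. Re (f y)) x) (real_cond_exp M F (\<lambda>y. Im (f y)) x)"

definition is_transfer :: "'a measure \<Rightarrow> ('a \<Rightarrow> 'a) \<Rightarrow> ('a \<Rightarrow> complex) \<Rightarrow> ('a \<Rightarrow> complex) \<Rightarrow> bool" where
  "is_transfer M T g h \<longleftrightarrow> integrable M h \<and>
     (\<forall>f. ess_bounded M f \<longrightarrow> (LINT x|M. f x * h x) = (LINT x|M. f (T x) * g x))"

text \<open>Elements of \<open>L\<^sup>1\<close> are represented by functions, so the transfer operator selects a
  representative. For an integrable argument a representative exists and is unique almost
  everywhere (\<open>is_transfer_transfer\<close> and \<open>is_transfer_unique\<close> below), and the operator maps
  \<open>L\<^sup>2\<close> to \<open>L\<^sup>2\<close> (\<open>square_integrable_transfer\<close>), so that \<open>L2_norm\<close> is the genuine norm of its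
  iterates.\<close>

definition transfer :: "'a measure \<Rightarrow> ('a \<Rightarrow> 'a) \<Rightarrow> ('a \<Rightarrow> complex) \<Rightarrow> 'a \<Rightarrow> complex" where
  "transfer M T g = (SOME h. is_transfer M T g h)"

definition convergence_system :: "'a measure \<Rightarrow> (nat \<Rightarrow> 'a \<Rightarrow> complex) \<Rightarrow> bool" where
  "convergence_system M \<phi> \<longleftrightarrow>
     (\<forall>a :: nat \<Rightarrow> complex. summable (\<lambda>n. (norm (a n))\<^sup>2) \<longrightarrow>
        (AE x in M. summable (\<lambda>n. a n * \<phi> n x)))"

lemma (in sigma_finite_subalgebra) complex_cond_exp_measurable:
  "complex_cond_exp M F f \<in> borel_measurable F"
proof -
  have "(\<lambda>x. complex_of_real (real_cond_exp M F (\<lambda>y. Re (f y)) x)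
      + \<i> * complex_of_real (real_cond_exp M F (\<lambda>y. Im (f y)) x)) \<in> borel_measurable F"
    by measurable
  then show ?thesis by (simp add: complex_cond_exp_def[abs_def] Complex_eq)
qed

lemma (in sigma_finite_subalgebra) complex_cond_exp_set_integral:
  assumes f: "integrable M f" and A: "A \<in> sets F"
  shows "integrable M (complex_cond_exp M F f)"
    and "(LINT x:A|M. complex_cond_exp M F f x) = (LINT x:A|M. f x)"
proof -
  have AM: "A \<in> sets M" using A subalg by (auto simp: subalgebra_def)
  let ?r = "real_cond_exp M F (\<lambda>y. Re (f y))" and ?i = "real_cond_exp M F (\<lambda>y. Im (f y))"
  have eq: "complex_cond_exp M F f = (\<lambda>x. complex_of_real (?r x) + \<i> * complex_of_real (?i x))"
    by (simp add: complex_cond_exp_def[abs_def] Complex_eq)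
  have r: "integrable M ?r" and i: "integrable M ?i"
    using real_cond_exp_int(1) integrable_Re[OF f] integrable_Im[OF f] by blast+
  show int: "integrable M (complex_cond_exp M F f)"
    unfolding eq
    using Bochner_Integration.integrable_add[OF integrable_of_real[OF r]
      integrable_mult_right[OF integrable_of_real[OF i]]] .
  have sint: "integrable M (\<lambda>x. indicator A x *\<^sub>R complex_cond_exp M F f x)"
    "integrable M (\<lambda>x. indicator A x *\<^sub>R f x)"
    using integrable_mult_indicator[OF AM] int f by blast+
  have "(LINT x:A|M. ?r x) = (LINT x:A|M. Re (f x))"
    using real_cond_exp_intA[OF integrable_Re[OF f] A] by simp
  moreover have "(LINT x:A|M. ?i x) = (LINT x:A|M. Im (f x))"
    using real_cond_exp_intA[OF integrable_Im[OF f] A] by simp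
  ultimately show "(LINT x:A|M. complex_cond_exp M F f x) = (LINT x:A|M. f x)"
    unfolding set_lebesgue_integral_def complex_eq_iff
      integral_Re[OF sint(1), symmetric] integral_Re[OF sint(2), symmetric]
      integral_Im[OF sint(1), symmetric] integral_Im[OF sint(2), symmetric]
    by (simp add: complex_cond_exp_def)
qed

context measure_preserving_system
begin

lemma distr_T: "distr M M T = M"
  using T_measurable T_preserving by (intro measure_eqI) (auto simp: emeasure_distr)

lemma AE_T: "AE x in M. P x \<Longrightarrow> AE x in M. P (T x)"
  using AE_distrD[OF T_measurable, of P] unfolding distr_T .

lemma funpow_T_measurable: "T ^^ m \<in> M \<rightarrow>\<^sub>M M"
proof (induction m)
  case (Suc m)
  show ?case using measurable_comp[OF Suc T_measurable] by (simp add: comp_def)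
qed (simp add: id_def)

lemma sets_pullback_algebra:
  "sets (pullback_algebra M T m) = {(T ^^ m) -` B \<inter> space M |B. B \<in> sets M}"
  unfolding pullback_algebra_def
  using measurable_space[OF funpow_T_measurable] by (intro sets_vimage_algebra2) auto

lemma subalgebra_pullback: "subalgebra M (pullback_algebra M T m)"
  unfolding subalgebra_def
  using sets_pullback_algebra measurable_sets[OF funpow_T_measurable]
  by (auto simp: pullback_algebra_def)

lemma integrable_bounded_mult:
  assumes "ess_bounded M f" "integrable M h"
  shows "integrable M (\<lambda>x. f x * h x)"
proof -
  obtain C where C: "AE x in M. norm (f x) \<le> C" and [measurable]: "f \<in> borel_measurable M"
    using assms(1) by (auto simp: ess_bounded_def)
  have [measurable]: "h \<in> borel_measurable M" using assms(2) by auto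
  show ?thesis
  proof (rule Bochner_Integration.integrable_bound)
    show "integrable M (\<lambda>x. C * norm (h x))" using assms(2) by auto
    show "AE x in M. norm (f x * h x) \<le> norm (C * norm (h x))"
      using C by eventually_elim (auto simp: norm_mult abs_mult intro!: mult_right_mono)
  qed auto
qed

lemma ess_bounded_T:
  assumes "ess_bounded M f"
  shows "ess_bounded M (\<lambda>x. f (T x))"
proof -
  obtain C where "AE x in M. norm (f x) \<le> C" and f: "f \<in> borel_measurable M"
    using assms by (auto simp: ess_bounded_def)
  then have "AE x in M. norm (f (T x)) \<le> C" by (intro AE_T)
  then show ?thesis
    unfolding ess_bounded_def using measurable_compose[OF T_measurable f] by (intro conjI exI)
qed

lemma transfer_exists_nonneg:
  fixes g :: "'a \<Rightarrow> real"
  assumes g: "integrable M g" and nonneg: "\<And>x. 0 \<le> g x"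
  shows "\<exists>h. is_transfer M T (\<lambda>x. of_real (g x)) h"
proof -
  note [measurable] = T_measurable
  have gm [measurable]: "g \<in> borel_measurable M" using g by auto
  define D where "D = density M (\<lambda>x. ennreal (g x))"
  define N where "N = distr D M T"
  have sD [measurable_cong]: "sets D = sets M" by (simp add: D_def)
  have fD: "finite_measure D"
  proof (rule finite_measureI)
    have "emeasure D (space D) = (\<integral>\<^sup>+x. ennreal (g x) \<partial>M)"
      unfolding D_def by (subst emeasure_density) (auto intro!: nn_integral_cong)
    also have "\<dots> = ennreal (LINT x|M. g x)"
      using g nonneg by (intro nn_integral_eq_integral) auto
    finally show "emeasure D (space D) \<noteq> \<infinity>" by simp
  qed
  have fN: "finite_measure N"
    unfolding N_def by (rule finite_measure.finite_measure_distr[OF fD]) measurable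
  interpret N: finite_measure N by (rule fN)
  have sN [measurable_cong]: "sets N = sets M" by (simp add: N_def)
  have ac: "absolutely_continuous M N"
    unfolding absolutely_continuous_def
  proof
    fix A assume A: "A \<in> null_sets M"
    then have [measurable]: "A \<in> sets M" by auto
    have "T -` A \<inter> space M \<in> null_sets M"
      using A T_preserving[of A] by (auto simp: null_sets_def)
    moreover have "absolutely_continuous M D"
      by (simp add: D_def absolutely_continuousI_density)
    ultimately have "T -` A \<inter> space M \<in> null_sets D" by (auto simp: absolutely_continuous_def)
    moreover have "T \<in> D \<rightarrow>\<^sub>M M" by measurable
    moreover have "space D = space M" using sD by (rule sets_eq_imp_space_eq)
    ultimately show "A \<in> null_sets N"
      by (auto simp: N_def null_sets_def emeasure_distr)
  qed
  obtain r where r: "r \<in> borel_measurable M" "AE x in M. RN_deriv M N x = ennreal (r x)"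
      "AE x in N. 0 < r x" "\<And>x. 0 \<le> r x"
    by (rule real_RN_deriv[OF fN ac sN]) (rule that)
  have [measurable]: "r \<in> borel_measurable M" by (rule r)
  have N_eq: "N = density M (\<lambda>x. ennreal (r x))"
  proof -
    have "N = density M (RN_deriv M N)" using density_RN_deriv[OF ac sN] by simp
    also have "\<dots> = density M (\<lambda>x. ennreal (r x))" using r(2) by (intro density_cong) auto
    finally show ?thesis .
  qed
  have r_int: "integrable M r"
  proof -
    have "integrable N (\<lambda>_. 1::real)" by simp
    then show ?thesis unfolding N_eq by (subst (asm) integrable_density) (auto simp: r(4))
  qed
  have "is_transfer M T (\<lambda>x. of_real (g x)) (\<lambda>x. of_real (r x))"
    unfolding is_transfer_def
  proof (intro conjI allI impI)
    show "integrable M (\<lambda>x. complex_of_real (r x))" using r_int by simp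
    fix f assume "ess_bounded M f"
    then have [measurable]: "f \<in> borel_measurable M" by (simp add: ess_bounded_def)
    have "(LINT x|M. f x * of_real (r x)) = integral\<^sup>L N f"
      unfolding N_eq by (subst integral_density) (auto simp: r(4) scaleR_conv_of_real mult.commute)
    also have "\<dots> = (LINT x|D. f (T x))"
      unfolding N_def by (rule integral_distr) measurable
    also have "\<dots> = (LINT x|M. f (T x) * of_real (g x))"
      unfolding D_def by (subst integral_density) (auto simp: nonneg scaleR_conv_of_real mult.commute)
    finally show "(LINT x|M. f x * of_real (r x)) = (LINT x|M. f (T x) * of_real (g x))" .
  qed
  then show ?thesis by blast
qed

lemma is_transfer_add_scaled:
  assumes "is_transfer M T g h" "is_transfer M T g' h'" "integrable M g" "integrable M g'"
  shows "is_transfer M T (\<lambda>x. g x + c * g' x) (\<lambda>x. h x + c * h' x)"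
  unfolding is_transfer_def
proof (intro conjI allI impI)
  show "integrable M (\<lambda>x. h x + c * h' x)" using assms by (auto simp: is_transfer_def)
  fix f assume f: "ess_bounded M f"
  have 1: "integrable M (\<lambda>x. f x * h x)" "integrable M (\<lambda>x. f x * h' x)"
    using assms f integrable_bounded_mult by (auto simp: is_transfer_def)
  have 2: "integrable M (\<lambda>x. f (T x) * g x)" "integrable M (\<lambda>x. f (T x) * g' x)"
    using assms integrable_bounded_mult[OF ess_bounded_T[OF f]] by auto
  have "(LINT x|M. f x * (h x + c * h' x)) = (LINT x|M. f x * h x + c * (f x * h' x))"
    by (simp add: algebra_simps)
  also have "\<dots> = (LINT x|M. f (T x) * g x + c * (f (T x) * g' x))"
    using 1 2 assms(1,2) f by (simp add: is_transfer_def)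
  finally show "(LINT x|M. f x * (h x + c * h' x)) = (LINT x|M. f (T x) * (g x + c * g' x))"
    by (simp add: algebra_simps)
qed

lemma transfer_exists:
  assumes g: "integrable M g"
  shows "\<exists>h. is_transfer M T g h"
proof -
  define p where "p s x = complex_of_real (max 0 (s x))" for s :: "'a \<Rightarrow> real" and x
  have int: "integrable M (p s)" if "integrable M s" for s
    unfolding p_def[abs_def]
    by (intro integrable_of_real Bochner_Integration.integrable_max integrable_zero that)
  have ex: "\<exists>h. is_transfer M T (p s) h" if "integrable M s" for s
    unfolding p_def[abs_def]
    by (intro transfer_exists_nonneg Bochner_Integration.integrable_max integrable_zero that) simp
  have R: "integrable M (\<lambda>x. Re (g x))" "integrable M (\<lambda>x. - Re (g x))"
    "integrable M (\<lambda>x. Im (g x))" "integrable M (\<lambda>x. - Im (g x))"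
    by (intro Bochner_Integration.integrable_minus integrable_Re integrable_Im g)+
  obtain h1 where h1: "is_transfer M T (p (\<lambda>x. Re (g x))) h1"
    using ex[OF R(1)] by (rule exE)
  obtain h2 where h2: "is_transfer M T (p (\<lambda>x. - Re (g x))) h2"
    using ex[OF R(2)] by (rule exE)
  obtain h3 where h3: "is_transfer M T (p (\<lambda>x. Im (g x))) h3"
    using ex[OF R(3)] by (rule exE)
  obtain h4 where h4: "is_transfer M T (p (\<lambda>x. - Im (g x))) h4"
    using ex[OF R(4)] by (rule exE)
  note i = int[OF R(1)] int[OF R(2)] int[OF R(3)] int[OF R(4)]
  note s1 = is_transfer_add_scaled[OF h1 h2 i(1,2), of "-1"]
  have i1: "integrable M (\<lambda>x. p (\<lambda>x. Re (g x)) x + -1 * p (\<lambda>x. - Re (g x)) x)"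
    using Bochner_Integration.integrable_add[OF i(1) integrable_mult_right[OF i(2)]] .
  note s2 = is_transfer_add_scaled[OF s1 h3 i1 i(3), of \<i>]
  have i2: "integrable M (\<lambda>x. (p (\<lambda>x. Re (g x)) x + -1 * p (\<lambda>x. - Re (g x)) x)
      + \<i> * p (\<lambda>x. Im (g x)) x)"
    using Bochner_Integration.integrable_add[OF i1 integrable_mult_right[OF i(3)]] .
  note s3 = is_transfer_add_scaled[OF s2 h4 i2 i(4), of "-\<i>"]
  have eq: "(\<lambda>x. ((p (\<lambda>x. Re (g x)) x + -1 * p (\<lambda>x. - Re (g x)) x)
      + \<i> * p (\<lambda>x. Im (g x)) x) + -\<i> * p (\<lambda>x. - Im (g x)) x) = g"
  proof
    fix x
    have p_diff: "p s x - p (\<lambda>x. - s x) x = of_real (s x)" for s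
      unfolding p_def of_real_diff[symmetric] by (rule arg_cong[of _ _ of_real]) (simp add: max_def)
    have "((p (\<lambda>x. Re (g x)) x + -1 * p (\<lambda>x. - Re (g x)) x)
        + \<i> * p (\<lambda>x. Im (g x)) x) + -\<i> * p (\<lambda>x. - Im (g x)) x
      = (p (\<lambda>x. Re (g x)) x - p (\<lambda>x. - Re (g x)) x)
        + \<i> * (p (\<lambda>x. Im (g x)) x - p (\<lambda>x. - Im (g x)) x)"
      by (simp add: algebra_simps)
    also have "\<dots> = of_real (Re (g x)) + \<i> * of_real (Im (g x))"
      by (simp only: p_diff[of "\<lambda>x. Re (g x)"] p_diff[of "\<lambda>x. Im (g x)"])
    also have "\<dots> = g x" by (rule complex_eq[symmetric])
    finally show "((p (\<lambda>x. Re (g x)) x + -1 * p (\<lambda>x. - Re (g x)) x)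
        + \<i> * p (\<lambda>x. Im (g x)) x) + -\<i> * p (\<lambda>x. - Im (g x)) x = g x" .
  qed
  show ?thesis by (rule exI) (rule s3[unfolded eq])
qed

lemma is_transfer_transfer: "integrable M g \<Longrightarrow> is_transfer M T g (transfer M T g)"
  unfolding transfer_def by (rule someI_ex[of "is_transfer M T g"]) (rule transfer_exists)

lemma is_transfer_unique:
  assumes "is_transfer M T g h" "is_transfer M T g h'"
  shows "AE x in M. h x = h' x"
proof (rule density_unique_banach)
  show "integrable M h" "integrable M h'" using assms by (auto simp: is_transfer_def)
  fix A assume A: "A \<in> sets M"
  have "ess_bounded M (indicator A)"
    unfolding ess_bounded_def using A by (auto intro!: exI[of _ 1] simp: indicator_def)
  then have "(LINT x|M. indicator A x * h x) = (LINT x|M. indicator A x * h' x)"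
    using assms by (simp add: is_transfer_def)
  moreover have "indicator A x *\<^sub>R z = indicator A x * z" for x and z :: complex
    by (cases "x \<in> A") auto
  ultimately show "set_lebesgue_integral M A h = set_lebesgue_integral M A h'"
    unfolding set_lebesgue_integral_def by simp
qed

lemma square_integrable_imp_integrable:
  assumes "square_integrable M g"
  shows "integrable M g"
proof (rule Bochner_Integration.integrable_bound)
  have [measurable]: "g \<in> borel_measurable M" using assms by (simp add: square_integrable_def)
  then show "g \<in> borel_measurable M" .
  show "integrable M (\<lambda>x. 1 + (norm (g x))\<^sup>2)" using assms by (simp add: square_integrable_def)
  have "t \<le> 1 + t\<^sup>2" for t :: real
    using sum_squares_bound[of t 1] by simp (smt (verit) zero_le_power2)
  then show "AE x in M. norm (g x) \<le> norm (1 + (norm (g x))\<^sup>2)" by simp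
qed

lemma square_integrable_is_transfer:
  assumes g: "square_integrable M g" and h: "is_transfer M T g h"
  shows "square_integrable M h"
proof -
  note [measurable] = T_measurable
  have [measurable]: "g \<in> borel_measurable M" and ig: "integrable M (\<lambda>x. (norm (g x))\<^sup>2)"
    using g by (auto simp: square_integrable_def)
  have [measurable]: "h \<in> borel_measurable M" using h by (auto simp: is_transfer_def)
  define c where "c n x = (if norm (h x) \<le> real n then cnj (h x) else 0)" for n x
  have [measurable]: "(\<lambda>x. cnj (h x)) \<in> borel_measurable M"
    by (rule measurable_compose[of h M borel]) (auto intro!: borel_measurable_continuous_onI continuous_intros)
  have [measurable]: "c n \<in> borel_measurable M" for n unfolding c_def by measurable
  have c_le: "norm (c n x) \<le> real n" for n x by (simp add: c_def)
  have c_bd: "ess_bounded M (c n)" for n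
    unfolding ess_bounded_def using c_le by auto
  have ic: "integrable M (\<lambda>x. (norm (c n x))\<^sup>2)" for n
    by (rule integrable_const_bound[of _ "(real n)\<^sup>2"]) (auto intro!: power_mono c_le)
  have icT: "integrable M (\<lambda>x. (norm (c n (T x)))\<^sup>2)" for n
    by (rule integrable_const_bound[of _ "(real n)\<^sup>2"]) (auto intro!: power_mono c_le)
  have cT: "(LINT x|M. (norm (c n (T x)))\<^sup>2) = (LINT x|M. (norm (c n x))\<^sup>2)" for n
    using integral_distr[of T M M "\<lambda>x. (norm (c n x))\<^sup>2"] by (simp add: distr_T)
  have bound: "(LINT x|M. (norm (c n x))\<^sup>2) \<le> (LINT x|M. (norm (g x))\<^sup>2)" for n
  proof -
    have "complex_of_real (LINT x|M. (norm (c n x))\<^sup>2) = (LINT x|M. of_real ((norm (c n x))\<^sup>2))"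
      by (rule integral_complex_of_real[symmetric])
    also have "\<dots> = (LINT x|M. c n x * h x)"
      by (intro Bochner_Integration.integral_cong)
        (auto simp: c_def mult.commute complex_norm_square simp del: of_real_power)
    also have "\<dots> = (LINT x|M. c n (T x) * g x)"
      using h c_bd by (simp add: is_transfer_def)
    finally have "\<bar>LINT x|M. (norm (c n x))\<^sup>2\<bar> = norm (LINT x|M. c n (T x) * g x)"
      by (metis norm_of_real real_norm_def)
    also have "\<dots> \<le> (LINT x|M. norm (c n (T x) * g x))"
      by (rule integral_norm_bound)
    also have "\<dots> \<le> (LINT x|M. ((norm (c n (T x)))\<^sup>2 + (norm (g x))\<^sup>2) / 2)"
    proof (rule integral_mono)
      show "integrable M (\<lambda>x. norm (c n (T x) * g x))"
        using integrable_bounded_mult[OF ess_bounded_T[OF c_bd] square_integrable_imp_integrable[OF g]]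
        by (rule integrable_norm)
      show "integrable M (\<lambda>x. ((norm (c n (T x)))\<^sup>2 + (norm (g x))\<^sup>2) / 2)"
        using icT ig by simp
      show "norm (c n (T x) * g x) \<le> ((norm (c n (T x)))\<^sup>2 + (norm (g x))\<^sup>2) / 2" for x
        using sum_squares_bound[of "norm (c n (T x))" "norm (g x)"] by (simp add: norm_mult)
    qed
    also have "\<dots> = ((LINT x|M. (norm (c n x))\<^sup>2) + (LINT x|M. (norm (g x))\<^sup>2)) / 2"
      using icT ig by (simp add: cT)
    finally have "(LINT x|M. (norm (c n x))\<^sup>2)
        \<le> ((LINT x|M. (norm (c n x))\<^sup>2) + (LINT x|M. (norm (g x))\<^sup>2)) / 2"
      by (rule abs_le_D1)
    moreover have "a \<le> b" if "a \<le> (a + b) / 2" for a b :: real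
      using that by simp
    ultimately show ?thesis by blast
  qed
  have "(\<integral>\<^sup>+x. ennreal ((norm (h x))\<^sup>2) \<partial>M) = (\<integral>\<^sup>+x. liminf (\<lambda>n. ennreal ((norm (c n x))\<^sup>2)) \<partial>M)"
  proof (rule nn_integral_cong)
    fix x
    obtain k :: nat where "norm (h x) \<le> real k" using real_arch_simple by blast
    then have "eventually (\<lambda>n. ennreal ((norm (c n x))\<^sup>2) = ennreal ((norm (h x))\<^sup>2)) sequentially"
      by (intro eventually_sequentiallyI[of k]) (auto simp: c_def)
    then have "(\<lambda>n. ennreal ((norm (c n x))\<^sup>2)) \<longlonglongrightarrow> ennreal ((norm (h x))\<^sup>2)"
      by (rule tendsto_eventually)
    then show "ennreal ((norm (h x))\<^sup>2) = liminf (\<lambda>n. ennreal ((norm (c n x))\<^sup>2))"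
      by (intro lim_imp_Liminf[symmetric]) auto
  qed
  also have "\<dots> \<le> liminf (\<lambda>n. \<integral>\<^sup>+x. ennreal ((norm (c n x))\<^sup>2) \<partial>M)"
    by (rule nn_integral_liminf) measurable
  also have "\<dots> \<le> liminf (\<lambda>n::nat. ennreal (LINT x|M. (norm (g x))\<^sup>2))"
    using ic bound by (intro Liminf_mono always_eventually allI)
      (simp add: nn_integral_eq_integral ennreal_leI)
  also have "\<dots> = ennreal (LINT x|M. (norm (g x))\<^sup>2)" by (simp add: Liminf_const)
  finally have "(\<integral>\<^sup>+x. ennreal ((norm (h x))\<^sup>2) \<partial>M) < \<infinity>"
    by (simp add: order_le_less_trans)
  then have "integrable M (\<lambda>x. (norm (h x))\<^sup>2)"
    by (intro integrableI_bounded) auto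
  then show ?thesis by (simp add: square_integrable_def)
qed

lemma square_integrable_transfer: "square_integrable M g \<Longrightarrow> square_integrable M (transfer M T g)"
  by (rule square_integrable_is_transfer[OF _ is_transfer_transfer[OF square_integrable_imp_integrable]])

end

end

theory Submission
  imports Defs
begin

text \<open>The idea is to write the orbit of \<open>f\<close> as a superposition of reverse martingale differences.
  Write \<open>L\<close> for the transfer operator and put \<open>g\<^sub>k = L\<^sup>k f - (L\<^sup>k\<^sup>+\<^sup>1 f) \<circ> T\<close>. A telescoping sum gives, at every
  point and for every \<open>m\<close>,
  \<open>f = (\<Sum>k<m. g\<^sub>k \<circ> T\<^sup>k) + (L\<^sup>m f) \<circ> T\<^sup>m\<close>.
  By the duality that defines \<open>L\<close>, each \<open>g\<^sub>k\<close> is orthogonal to all functions \<open>\<phi> \<circ> T\<close> with \<open>\<phi>\<close>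
  square integrable; in other words, \<open>\<lambda>n. g\<^sub>k \<circ> T\<^sup>n\<close> is a reverse martingale difference sequence.

  Two consequences of this orthogonality carry the proof. The first is Pythagoras:
  the squared norm of \<open>g\<^sub>k\<close> is \<open>b\<^sub>k\<^sup>2 - b\<^sub>k\<^sub>+\<^sub>1\<^sup>2\<close> with \<open>b\<^sub>k = \<parallel>L\<^sup>k f\<parallel>\<^sub>2\<close>
  (\<open>L2_norm_power2_innovation\<close>), so that \<open>b\<close> decreases and summability of \<open>b\<^sub>n / \<surd>n\<close> forces
  \<open>\<Sum>\<^sub>k \<parallel>g\<^sub>k\<parallel>\<^sub>2 < \<infinity>\<close> (\<open>summable_sqrt_square_decrements\<close>). The second is a maximal inequality of
  Doob type: the mean of the largest partial sum of \<open>\<Sum>\<^sub>n a\<^sub>n g\<^sub>k \<circ> T\<^sup>n\<close> is at most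
  \<open>4 \<parallel>a\<parallel>\<^sub>2 \<parallel>g\<^sub>k\<parallel>\<^sub>2\<close> (\<open>integral_max_tail_sum_le\<close>).

  Since \<open>T\<close> preserves the measure, the maximal inequalities add up over \<open>k\<close>, and \<open>b\<^sub>m \<longlonglongrightarrow> 0\<close>
  disposes of the remainder: the mean of the largest partial sum of \<open>\<Sum>\<^sub>n a\<^sub>n f \<circ> T\<^sup>n\<close> is at most
  \<open>4 \<parallel>a\<parallel>\<^sub>2 (\<Sum>\<^sub>k \<parallel>g\<^sub>k\<parallel>\<^sub>2)\<close> (\<open>nn_integral_sup_orbit_sum_le\<close>). Applied to the tails of \<open>a\<close>, this
  makes the oscillation of the partial sums beyond \<open>p\<close> small in mean, hence their Cauchy property
  holds almost everywhere.\<close>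

section \<open>Decreasing sequences summable against inverse square roots\<close>

text \<open>Summation by parts moves the differences onto the weights, and consecutive weights differ by
  \<open>\<surd>(k + 1) - \<surd>k = 1 / (\<surd>(k + 1) + \<surd>k)\<close>.\<close>
lemma abel_summation_sqrt_bound:
  fixes b :: "nat \<Rightarrow> real"
  assumes nonneg: "\<And>k. 0 \<le> b k"
  shows "(\<Sum>k<n. sqrt (real (Suc k)) * (b k - b (Suc k))) \<le> (\<Sum>k<n. b k / sqrt (real (Suc k)))"
proof -
  have increment: "sqrt (real (Suc k)) - sqrt (real k) \<le> 1 / sqrt (real (Suc k))" for k
  proof -
    have "sqrt (real k) * sqrt (real k) \<le> sqrt (real k) * sqrt (real (Suc k))"
      by (intro mult_left_mono) auto
    then have "(sqrt (real (Suc k)) - sqrt (real k)) * sqrt (real (Suc k)) \<le> 1"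
      by (simp add: left_diff_distrib)
    then show ?thesis by (simp add: field_simps)
  qed
  have "(\<Sum>k<n. sqrt (real (Suc k)) * (b k - b (Suc k))) + sqrt (real n) * b n
      \<le> (\<Sum>k<n. b k / sqrt (real (Suc k)))"
  proof (induction n)
    case (Suc n)
    have "b n * (sqrt (real (Suc n)) - sqrt (real n)) \<le> b n * (1 / sqrt (real (Suc n)))"
      by (intro mult_left_mono increment nonneg)
    with Suc show ?case by (simp add: algebra_simps del: of_nat_Suc)
  qed simp
  moreover have "0 \<le> sqrt (real n) * b n" using nonneg by simp
  ultimately show ?thesis by linarith
qed

text \<open>Factor \<open>b\<^sub>k\<^sup>2 - b\<^sub>k\<^sub>+\<^sub>1\<^sup>2\<close> as a difference times a sum. Weighting the two factors by
  \<open>\<surd>(k + 1)\<close> and its inverse before using the inequality of arithmetic and geometric means leaves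
  the Abel sum bounded above plus a multiple of the given series.\<close>
lemma summable_sqrt_square_decrements:
  fixes b :: "nat \<Rightarrow> real"
  assumes nonneg: "\<And>k. 0 \<le> b k" and decr: "\<And>k. b (Suc k) \<le> b k"
    and summable: "summable (\<lambda>k. b k / sqrt (real (Suc k)))"
  shows "summable (\<lambda>k. sqrt ((b k)\<^sup>2 - (b (Suc k))\<^sup>2))"
proof -
  have "summable (\<lambda>k. sqrt (real (Suc k)) * (b k - b (Suc k)))"
  proof (rule summableI_nonneg_bounded)
    show "0 \<le> sqrt (real (Suc k)) * (b k - b (Suc k))" for k
      using decr[of k] by simp
    show "(\<Sum>k<n. sqrt (real (Suc k)) * (b k - b (Suc k))) \<le> (\<Sum>k. b k / sqrt (real (Suc k)))" for n
      using nonneg by (intro order_trans[OF abel_summation_sqrt_bound] sum_le_suminf summable) auto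
  qed
  then have dom: "summable (\<lambda>k. sqrt (real (Suc k)) * (b k - b (Suc k))
      + 2 * (b k / sqrt (real (Suc k))))"
    using summable by (intro summable_add summable_mult)
  show ?thesis
  proof (rule summable_comparison_test'[OF dom, of 0])
    fix k
    define s where "s = sqrt (real (Suc k))"
    have s: "0 < s" by (simp add: s_def)
    have d: "0 \<le> b k - b (Suc k)" using decr[of k] by simp
    have "sqrt ((b k)\<^sup>2 - (b (Suc k))\<^sup>2)
        = sqrt ((s * (b k - b (Suc k))) * ((b k + b (Suc k)) / s))"
      using s by (simp add: field_simps power2_eq_square)
    also have "\<dots> \<le> (s * (b k - b (Suc k)) + (b k + b (Suc k)) / s) / 2"
      using s d nonneg[of k] nonneg[of "Suc k"] by (intro arith_geo_mean_sqrt) auto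
    also have "\<dots> \<le> s * (b k - b (Suc k)) + 2 * (b k / s)"
    proof -
      have "(b k + b (Suc k)) / s \<le> 2 * (b k / s)"
        using d s by (simp add: field_simps)
      moreover have "0 \<le> s * (b k - b (Suc k))" "0 \<le> b k / s"
        using s d nonneg[of k] by auto
      moreover have "(p + q) / 2 \<le> p + 2 * r" if "q \<le> 2 * r" "0 \<le> p" "0 \<le> r" for p q r :: real
        using that by simp
      ultimately show ?thesis by blast
    qed
    finally show "norm (sqrt ((b k)\<^sup>2 - (b (Suc k))\<^sup>2))
        \<le> sqrt (real (Suc k)) * (b k - b (Suc k)) + 2 * (b k / sqrt (real (Suc k)))"
      using d nonneg[of "Suc k"] by (simp add: s_def power_mono)
  qed
qed

text \<open>By monotonicity the first \<open>n + 1\<close> terms of the series are each at least \<open>b\<^sub>n / \<surd>(n + 1)\<close>, so that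
  \<open>\<surd>(n + 1) b\<^sub>n\<close> stays bounded.\<close>
lemma decreasing_tendsto_0_if_summable_over_sqrt:
  fixes b :: "nat \<Rightarrow> real"
  assumes nonneg: "\<And>k. 0 \<le> b k" and decr: "\<And>k. b (Suc k) \<le> b k"
    and summable: "summable (\<lambda>k. b k / sqrt (real (Suc k)))"
  shows "b \<longlonglongrightarrow> 0"
proof (rule tendsto_sandwich[where f="\<lambda>_. 0"])
  define C where "C = (\<Sum>k. b k / sqrt (real (Suc k)))"
  have "b n \<le> C / sqrt (real (Suc n))" for n
  proof -
    have anti: "b n \<le> b k" if "k \<le> n" for k
      using decr that by (rule lift_Suc_antimono_le)
    have "sqrt (real (Suc n)) * b n = real (Suc n) * (b n / sqrt (real (Suc n)))"
      using real_div_sqrt[of "real (Suc n)"] by (metis of_nat_0_le_iff times_divide_eq_left times_divide_eq_right)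
    also have "\<dots> = (\<Sum>k<Suc n. b n / sqrt (real (Suc n)))"
      by simp
    also have "\<dots> \<le> (\<Sum>k<Suc n. b k / sqrt (real (Suc k)))"
      using nonneg anti by (intro sum_mono frac_le) auto
    also have "\<dots> \<le> C"
      unfolding C_def using nonneg by (intro sum_le_suminf summable) auto
    finally show ?thesis by (simp add: pos_le_divide_eq mult.commute del: of_nat_Suc)
  qed
  then show "\<forall>\<^sub>F n in sequentially. b n \<le> C / sqrt (real (Suc n))" by simp
  show "(\<lambda>n. C / sqrt (real (Suc n))) \<longlonglongrightarrow> 0"
    by (rule real_tendsto_divide_at_top[OF tendsto_const filterlim_compose[OF sqrt_at_top
        filterlim_compose[OF filterlim_real_sequentially filterlim_Suc]]])
qed (use nonneg in auto)

section \<open>Square integrable functions\<close>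
lemma square_integrable_measurable: "square_integrable M g \<Longrightarrow> g \<in> borel_measurable M"
  by (simp add: square_integrable_def)

lemma square_integrable_bound:
  assumes "square_integrable M g" and "h \<in> borel_measurable M" and "\<And>x. norm (h x) \<le> norm (g x)"
  shows "square_integrable M h"
  unfolding square_integrable_def
proof
  show "integrable M (\<lambda>x. (norm (h x))\<^sup>2)"
    by (rule Bochner_Integration.integrable_bound[of M "\<lambda>x. (norm (g x))\<^sup>2"])
      (use assms in \<open>auto simp: square_integrable_def intro!: power_mono\<close>)
qed (rule assms)

lemma integrable_mult_square_integrable:
  assumes "square_integrable M g" "square_integrable M h"
  shows "integrable M (\<lambda>x. g x * h x)"
proof (rule Bochner_Integration.integrable_bound)
  show "integrable M (\<lambda>x. (norm (g x))\<^sup>2 + (norm (h x))\<^sup>2)"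
    using assms by (simp add: square_integrable_def)
  show "(\<lambda>x. g x * h x) \<in> borel_measurable M"
    using assms[THEN square_integrable_measurable] by (rule borel_measurable_times)
  have "r * s \<le> r\<^sup>2 + s\<^sup>2" if "0 \<le> r" "0 \<le> s" for r s :: real
  proof -
    have "0 \<le> r * s" using that by simp
    then show ?thesis using sum_squares_bound[of r s] by linarith
  qed
  then show "AE x in M. norm (g x * h x) \<le> norm ((norm (g x))\<^sup>2 + (norm (h x))\<^sup>2)"
    by (simp add: norm_mult)
qed

lemma square_integrable_mult_const:
  "square_integrable M g \<Longrightarrow> square_integrable M (\<lambda>x. c * g x)"
  by (auto simp: square_integrable_def norm_mult power_mult_distrib)

lemma square_integrable_add:
  assumes "square_integrable M g" "square_integrable M h"
  shows "square_integrable M (\<lambda>x. g x + h x)"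
  unfolding square_integrable_def
proof
  note [measurable] = assms[THEN square_integrable_measurable]
  show "(\<lambda>x. g x + h x) \<in> borel_measurable M" by measurable
  show "integrable M (\<lambda>x. (norm (g x + h x))\<^sup>2)"
  proof (rule Bochner_Integration.integrable_bound)
    show "integrable M (\<lambda>x. 2 * ((norm (g x))\<^sup>2 + (norm (h x))\<^sup>2))"
      using assms by (simp add: square_integrable_def)
    have "(norm (z + w))\<^sup>2 \<le> 2 * ((norm z)\<^sup>2 + (norm w)\<^sup>2)" for z w :: complex
    proof -
      have "(norm (z + w))\<^sup>2 \<le> (norm z + norm w)\<^sup>2"
        by (intro power_mono norm_triangle_ineq) simp
      also have "\<dots> \<le> 2 * ((norm z)\<^sup>2 + (norm w)\<^sup>2)"
        using sum_squares_bound[of "norm z" "norm w"] by (simp add: power2_sum)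
      finally show ?thesis .
    qed
    then show "AE x in M. norm ((norm (g x + h x))\<^sup>2) \<le> norm (2 * ((norm (g x))\<^sup>2 + (norm (h x))\<^sup>2))"
      by simp
  qed measurable
qed

lemma square_integrable_diff:
  assumes "square_integrable M g" "square_integrable M h"
  shows "square_integrable M (\<lambda>x. g x - h x)"
  using square_integrable_add[OF assms(1) square_integrable_mult_const[OF assms(2), of "-1"]] by simp

lemma borel_measurable_cnj [measurable (raw)]:
  "g \<in> borel_measurable M \<Longrightarrow> (\<lambda>x. cnj (g x)) \<in> borel_measurable M"
  by (rule measurable_compose[of g M borel])
    (auto intro!: borel_measurable_continuous_onI continuous_intros)

lemma square_integrable_cnj: "square_integrable M g \<Longrightarrow> square_integrable M (\<lambda>x. cnj (g x))"
  by (auto simp: square_integrable_def)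

section \<open>Pointwise inequalities behind the maximal inequality\<close>

text \<open>The tangent inequality for the convex function \<open>norm\<close>. It turns a martingale increment into a
  lower bound for the increment of the norm, and so replaces the conditional Jensen inequality.\<close>
lemma norm_diff_ge_Re_cnj_sgn:
  fixes z w :: complex
  shows "Re (cnj (sgn z) * w) \<le> norm (z + w) - norm z"
proof -
  have "Re (cnj (sgn z) * (z + w)) \<le> norm (cnj (sgn z) * (z + w))" by (rule complex_Re_le_cmod)
  also have "\<dots> \<le> norm (z + w)" by (simp add: norm_mult norm_sgn)
  also have "cnj (sgn z) * z = of_real (norm z)"
  proof (cases "z = 0")
    case False
    have "cnj (sgn z) * z = (z * cnj z) / of_real (norm z)"
      by (simp add: sgn_div_norm scaleR_conv_of_real divide_inverse mult_ac)
    also have "\<dots> = of_real ((norm z)\<^sup>2) / of_real (norm z)"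
      unfolding complex_norm_square[symmetric] ..
    finally show ?thesis using False by (simp add: power2_eq_square)
  qed simp
  then have "Re (cnj (sgn z) * (z + w)) = norm z + Re (cnj (sgn z) * w)"
    by (simp only: distrib_left) simp
  ultimately show ?thesis by simp
qed

text \<open>For the current value \<open>s\<close> and running maximum \<open>m\<close> of a nonnegative process, the potential
  \<open>2 m\<^sup>2 - 4 m s\<close> dominates \<open>m\<^sup>2 - 4 s\<^sup>2\<close>, the quantity that Doob's inequality bounds in mean. Raising
  the maximum to a new value \<open>s'\<close> does not increase the potential, so a step changes it by at most
  the linear term \<open>- 4 m (s' - s)\<close>.\<close>
lemma doob_potential_step:
  fixes m s s' :: real
  shows "2 * (max s' m)\<^sup>2 - 4 * max s' m * s' \<le> 2 * m\<^sup>2 - 4 * m * s'"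
proof (cases "s' \<le> m")
  case False
  have "0 \<le> 2 * (s' - m)\<^sup>2" by simp
  with False show ?thesis by (simp add: max_def power2_diff power2_eq_square algebra_simps)
qed (simp add: max_def)

section \<open>Invariance and duality in the space of square integrable functions\<close>

context measure_preserving_system
begin

lemma integral_compose_T:
  fixes g :: "'a \<Rightarrow> 'b::{banach, second_countable_topology}"
  assumes "g \<in> borel_measurable M"
  shows "(LINT x|M. g (T x)) = (LINT x|M. g x)"
  using integral_distr[OF T_measurable assms] by (simp add: distr_T)

lemma integrable_compose_T:
  fixes g :: "'a \<Rightarrow> 'b::{banach, second_countable_topology}"
  assumes "integrable M g"
  shows "integrable M (\<lambda>x. g (T x))"
  using integrable_distr[OF T_measurable, of g] assms by (simp add: distr_T)

lemma nn_integral_compose_T: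
  assumes "g \<in> borel_measurable M"
  shows "(\<integral>\<^sup>+x. g (T x) \<partial>M) = (\<integral>\<^sup>+x. g x \<partial>M)"
  using nn_integral_distr[OF T_measurable, of g] assms by (simp add: distr_T)

lemma square_integrable_compose_T:
  assumes "square_integrable M g"
  shows "square_integrable M (\<lambda>x. g (T x))"
  using assms integrable_compose_T[of "\<lambda>x. (norm (g x))\<^sup>2"]
    measurable_compose[OF T_measurable, of g borel] by (simp add: square_integrable_def)

lemma square_integrable_transfer_power:
  "square_integrable M g \<Longrightarrow> square_integrable M ((transfer M T ^^ k) g)"
  by (induction k) (auto intro: square_integrable_transfer)

lemma integral_norm_le_L2_norm:
  assumes "square_integrable M g"
  shows "(LINT x|M. norm (g x)) \<le> L2_norm M g"
proof -
  have int: "integrable M (\<lambda>x. norm (g x))" "integrable M (\<lambda>x. (norm (g x))\<^sup>2)"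
    using assms square_integrable_imp_integrable[OF assms] by (auto simp: square_integrable_def)
  have "0 \<le> variance (\<lambda>x. norm (g x))" by (rule variance_positive)
  then have "(LINT x|M. norm (g x))\<^sup>2 \<le> (LINT x|M. (norm (g x))\<^sup>2)"
    using variance_eq[OF int] by simp
  then show ?thesis unfolding L2_norm_def by (rule real_le_rsqrt)
qed

text \<open>The transfer operator is defined by duality with bounded functions. Truncating \<open>\<phi>\<close> and passing
  to the limit by dominated convergence extends the duality to square integrable \<open>\<phi>\<close>. The extension
  is needed because the test function of the maximal inequality is a partial sum.\<close>
lemma transfer_duality_L2:
  assumes g: "square_integrable M g" and \<phi>: "square_integrable M \<phi>"
  shows "(LINT x|M. \<phi> x * transfer M T g x) = (LINT x|M. \<phi> (T x) * g x)"
proof (rule LIMSEQ_unique)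
  define c where "c n x = (if norm (\<phi> x) \<le> real n then \<phi> x else 0)" for n x
  note [measurable] = T_measurable square_integrable_measurable[OF g]
    square_integrable_measurable[OF \<phi>] square_integrable_measurable[OF square_integrable_transfer[OF g]]
  have [measurable]: "c n \<in> borel_measurable M" for n unfolding c_def by measurable
  have lim: "(\<lambda>n. c n x) \<longlonglongrightarrow> \<phi> x" for x
  proof -
    obtain k :: nat where "norm (\<phi> x) \<le> real k" using real_arch_simple by blast
    then have "\<forall>\<^sub>F n in sequentially. c n x = \<phi> x"
      by (intro eventually_sequentiallyI[of k]) (auto simp: c_def)
    then show ?thesis by (rule tendsto_eventually)
  qed
  have le: "norm (c n x) \<le> norm (\<phi> x)" for n x by (simp add: c_def)
  have "ess_bounded M (c n)" for n
    unfolding ess_bounded_def by (auto simp: c_def intro!: exI[of _ "real n"])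
  then have eq: "(LINT x|M. c n x * transfer M T g x) = (LINT x|M. c n (T x) * g x)" for n
    using is_transfer_transfer[OF square_integrable_imp_integrable[OF g]]
    by (simp add: is_transfer_def)
  show "(\<lambda>n. LINT x|M. c n x * transfer M T g x) \<longlonglongrightarrow> (LINT x|M. \<phi> x * transfer M T g x)"
  proof (rule integral_dominated_convergence)
    show "integrable M (\<lambda>x. norm (\<phi> x * transfer M T g x))"
      using integrable_mult_square_integrable[OF \<phi> square_integrable_transfer[OF g]]
      by (rule integrable_norm)
    show "AE x in M. norm (c n x * transfer M T g x) \<le> norm (\<phi> x * transfer M T g x)" for n
      using le by (auto simp: norm_mult intro!: mult_right_mono)
    show "AE x in M. (\<lambda>n. c n x * transfer M T g x) \<longlonglongrightarrow> \<phi> x * transfer M T g x"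
      by (intro AE_I2 tendsto_intros lim)
  qed measurable
  have "(\<lambda>n. LINT x|M. c n (T x) * g x) \<longlonglongrightarrow> (LINT x|M. \<phi> (T x) * g x)"
  proof (rule integral_dominated_convergence)
    show "integrable M (\<lambda>x. norm (\<phi> (T x) * g x))"
      using integrable_mult_square_integrable[OF square_integrable_compose_T[OF \<phi>] g]
      by (rule integrable_norm)
    show "AE x in M. norm (c n (T x) * g x) \<le> norm (\<phi> (T x) * g x)" for n
      using le by (auto simp: norm_mult intro!: mult_right_mono)
    show "AE x in M. (\<lambda>n. c n (T x) * g x) \<longlonglongrightarrow> \<phi> (T x) * g x"
      by (intro AE_I2 tendsto_intros lim)
  qed measurable
  then show "(\<lambda>n. LINT x|M. c n x * transfer M T g x) \<longlonglongrightarrow> (LINT x|M. \<phi> (T x) * g x)"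
    by (simp add: eq)
qed

text \<open>This is the condition that the conditional expectation of \<open>g\<close> given the pullback of the
  \<open>\<sigma>\<close>-algebra under \<open>T\<close> vanishes, expressed by orthogonality.\<close>
definition orthogonal_to_pullbacks :: "('a \<Rightarrow> complex) \<Rightarrow> bool" where
  "orthogonal_to_pullbacks g \<longleftrightarrow> square_integrable M g \<and>
     (\<forall>\<phi>. square_integrable M \<phi> \<longrightarrow> (LINT x|M. \<phi> (T x) * g x) = 0)"

lemma orthogonal_to_pullbacks_diff_transfer:
  assumes g: "square_integrable M g"
  shows "orthogonal_to_pullbacks (\<lambda>x. g x - transfer M T g (T x))"
  unfolding orthogonal_to_pullbacks_def
proof (intro conjI allI impI)
  have Lg: "square_integrable M (transfer M T g)" by (rule square_integrable_transfer[OF g])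
  note LgT = square_integrable_compose_T[OF Lg]
  show "square_integrable M (\<lambda>x. g x - transfer M T g (T x))"
    by (rule square_integrable_diff[OF g LgT])
  fix \<phi> assume \<phi>: "square_integrable M \<phi>"
  note \<phi>T = square_integrable_compose_T[OF \<phi>]
  note [measurable] = Lg[THEN square_integrable_measurable] \<phi>[THEN square_integrable_measurable]
  have "(LINT x|M. \<phi> (T x) * (g x - transfer M T g (T x)))
      = (LINT x|M. \<phi> (T x) * g x) - (LINT x|M. \<phi> (T x) * transfer M T g (T x))"
    unfolding right_diff_distrib
    by (intro Bochner_Integration.integral_diff integrable_mult_square_integrable \<phi>T g LgT)
  also have "(LINT x|M. \<phi> (T x) * transfer M T g (T x)) = (LINT x|M. \<phi> x * transfer M T g x)"
    by (rule integral_compose_T[where g="\<lambda>x. \<phi> x * transfer M T g x"]) measurable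
  finally show "(LINT x|M. \<phi> (T x) * (g x - transfer M T g (T x))) = 0"
    by (simp add: transfer_duality_L2[OF g \<phi>])
qed

text \<open>Pythagoras, with the invariance of the measure used to drop \<open>T\<close> from the last term. The two
  instances of interest are one further term of an orbit sum and the splitting of \<open>L\<^sup>k f\<close> into
  \<open>g\<^sub>k\<close> and \<open>(L\<^sup>k\<^sup>+\<^sup>1 f) \<circ> T\<close>.\<close>
lemma integral_norm_square_add_pullback:
  assumes g: "orthogonal_to_pullbacks g" and u: "square_integrable M u"
  shows "(LINT x|M. (norm (c * g x + u (T x)))\<^sup>2)
      = (norm c)\<^sup>2 * (LINT x|M. (norm (g x))\<^sup>2) + (LINT x|M. (norm (u x))\<^sup>2)"
proof -
  have g2: "square_integrable M g" using g by (simp add: orthogonal_to_pullbacks_def)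
  note uT = square_integrable_compose_T[OF u] and um = square_integrable_measurable[OF u]
  have cross: "integrable M (\<lambda>x. c * (cnj (u (T x)) * g x))"
    by (intro integrable_mult_right integrable_mult_square_integrable square_integrable_cnj uT g2)
  have cross0: "(LINT x|M. Re (c * (cnj (u (T x)) * g x))) = 0"
    unfolding integral_Re[OF cross]
    using g[unfolded orthogonal_to_pullbacks_def, THEN conjunct2, rule_format, OF square_integrable_cnj[OF u]]
    by simp
  have cross_int: "integrable M (\<lambda>x. Re (c * (cnj (u (T x)) * g x)))"
    using cross by (rule integrable_Re)
  have int: "integrable M (\<lambda>x. (norm (g x))\<^sup>2)" "integrable M (\<lambda>x. (norm (u (T x)))\<^sup>2)"
    using g2 uT by (simp_all add: square_integrable_def)
  have expand: "(norm (c * z + w))\<^sup>2 = ((norm c)\<^sup>2 * (norm z)\<^sup>2 + (norm w)\<^sup>2) + 2 * Re (c * (cnj w * z))"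
    for z w :: complex
    unfolding norm_mult[symmetric] power_mult_distrib[symmetric] cmod_power2
    by (simp add: power2_eq_square algebra_simps)
  have "(LINT x|M. (norm (c * g x + u (T x)))\<^sup>2)
      = (norm c)\<^sup>2 * (LINT x|M. (norm (g x))\<^sup>2) + (LINT x|M. (norm (u (T x)))\<^sup>2)"
    unfolding expand using int cross_int cross0 by (simp del: times_complex.sel)
  also have "(LINT x|M. (norm (u (T x)))\<^sup>2) = (LINT x|M. (norm (u x))\<^sup>2)"
    using um by (intro integral_compose_T[where g="\<lambda>x. (norm (u x))\<^sup>2"]) simp
  finally show ?thesis .
qed

section \<open>A maximal inequality for reverse martingale differences\<close>
definition orbit_sum :: "('a \<Rightarrow> complex) \<Rightarrow> nat \<Rightarrow> (nat \<Rightarrow> complex) \<Rightarrow> 'a \<Rightarrow> complex" where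
  "orbit_sum g n a x = (\<Sum>i<n. a i * g ((T ^^ i) x))"

lemma orbit_sum_0 [simp]: "orbit_sum g 0 a x = 0"
  by (simp add: orbit_sum_def)

text \<open>Splitting off the first term: everything that follows is evaluated at \<open>T x\<close>. Hence the
  martingale unfolds from the last term towards the first, and the recursion replaces a filtration.\<close>
lemma orbit_sum_Suc:
  "orbit_sum g (Suc n) a x = a 0 * g x + orbit_sum g n (\<lambda>i. a (Suc i)) (T x)"
  unfolding orbit_sum_def sum.lessThan_Suc_shift by (simp add: funpow_swap1)

lemma square_integrable_orbit_sum:
  assumes "square_integrable M g"
  shows "square_integrable M (orbit_sum g n a)"
proof (induction n arbitrary: a)
  case 0
  show ?case by (simp add: square_integrable_def orbit_sum_def[abs_def])
next
  case (Suc n)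
  show ?case
    unfolding orbit_sum_Suc[abs_def]
    by (intro square_integrable_add square_integrable_mult_const assms square_integrable_compose_T Suc)
qed

text \<open>The running maximum of the martingale just described: the largest modulus of the sums of the
  last terms of \<open>orbit_sum g n a x\<close>.\<close>
primrec max_tail_sum :: "('a \<Rightarrow> complex) \<Rightarrow> nat \<Rightarrow> (nat \<Rightarrow> complex) \<Rightarrow> 'a \<Rightarrow> real" where
  "max_tail_sum g 0 a x = 0"
| "max_tail_sum g (Suc n) a x =
     max (norm (orbit_sum g (Suc n) a x)) (max_tail_sum g n (\<lambda>i. a (Suc i)) (T x))"

lemma norm_orbit_sum_diff_le_max_tail_sum:
  "j \<le> n \<Longrightarrow> norm (orbit_sum g n a x - orbit_sum g j a x) \<le> max_tail_sum g n a x"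
proof (induction n arbitrary: j a x)
  case (Suc n)
  show ?case
  proof (cases j)
    case (Suc i)
    then have "norm (orbit_sum g n (\<lambda>i. a (Suc i)) (T x) - orbit_sum g i (\<lambda>i. a (Suc i)) (T x))
        \<le> max_tail_sum g n (\<lambda>i. a (Suc i)) (T x)"
      using Suc.prems by (intro Suc.IH) simp
    then show ?thesis by (simp add: Suc orbit_sum_Suc)
  qed simp
qed simp

lemma max_tail_sum_nonneg: "0 \<le> max_tail_sum g n a x"
  by (cases n) (auto simp: le_max_iff_disj)

text \<open>A partial sum is the difference of the full sum and a tail, and both of these are tails.\<close>
lemma norm_orbit_sum_le_max_tail_sum:
  assumes "j \<le> n"
  shows "norm (orbit_sum g j a x) \<le> 2 * max_tail_sum g n a x"
proof -
  have "norm (orbit_sum g j a x)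
      \<le> norm (orbit_sum g n a x) + norm (orbit_sum g n a x - orbit_sum g j a x)"
    by norm
  then show ?thesis
    using norm_orbit_sum_diff_le_max_tail_sum[OF assms, of g a x]
      norm_orbit_sum_diff_le_max_tail_sum[of 0 n g a x] by simp
qed

lemma square_integrable_max_tail_sum:
  assumes "square_integrable M g"
  shows "square_integrable M (\<lambda>x. of_real (max_tail_sum g n a x))"
proof (induction n arbitrary: a)
  case (Suc n)
  let ?Q = "orbit_sum g (Suc n) a" and ?m = "\<lambda>x. max_tail_sum g n (\<lambda>i. a (Suc i)) (T x)"
  note Q = square_integrable_orbit_sum[OF assms, of "Suc n" a]
  have m: "square_integrable M (\<lambda>x. of_real (?m x))"
    by (rule square_integrable_compose_T[OF Suc])
  have Q': "square_integrable M (\<lambda>x. of_real (norm (?Q x)))"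
    by (rule square_integrable_bound[OF Q])
      (use square_integrable_measurable[OF Q] in \<open>simp_all del: max_tail_sum.simps\<close>)
  have [measurable]: "?Q \<in> borel_measurable M" by (rule square_integrable_measurable[OF Q])
  have "(\<lambda>x. Re (of_real (?m x))) \<in> borel_measurable M"
    by (rule measurable_compose[OF square_integrable_measurable[OF m] borel_measurable_Re])
  then have [measurable]: "?m \<in> borel_measurable M" by simp
  show ?case
  proof (rule square_integrable_bound[OF square_integrable_add[OF Q' m]])
    show "(\<lambda>x. complex_of_real (max_tail_sum g (Suc n) a x)) \<in> borel_measurable M"
      unfolding max_tail_sum.simps by measurable
    fix x
    show "norm (complex_of_real (max_tail_sum g (Suc n) a x))
        \<le> norm (complex_of_real (norm (?Q x)) + complex_of_real (?m x))"
      using max_tail_sum_nonneg[of g n "\<lambda>i. a (Suc i)" "T x"]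
      unfolding of_real_add[symmetric] norm_of_real by (simp add: max_def)
  qed
qed (simp add: square_integrable_def)

lemma borel_measurable_max_tail_sum:
  assumes "square_integrable M g"
  shows "max_tail_sum g n a \<in> borel_measurable M"
  using measurable_compose[OF square_integrable_measurable[OF square_integrable_max_tail_sum[OF assms, of n a]]
      borel_measurable_Re]
  by simp

text \<open>The summands are pairwise orthogonal.\<close>
lemma integral_norm_square_orbit_sum:
  assumes g: "orthogonal_to_pullbacks g"
  shows "(LINT x|M. (norm (orbit_sum g n a x))\<^sup>2)
      = (\<Sum>i<n. (norm (a i))\<^sup>2) * (LINT x|M. (norm (g x))\<^sup>2)"
proof (induction n arbitrary: a)
  case (Suc n)
  have "square_integrable M (orbit_sum g n (\<lambda>i. a (Suc i)))"
    using g by (intro square_integrable_orbit_sum) (simp add: orthogonal_to_pullbacks_def)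
  from integral_norm_square_add_pullback[OF g this, of "a 0"]
  show ?case
    by (simp only: orbit_sum_Suc Suc sum.lessThan_Suc_shift) (simp add: algebra_simps)
qed simp

text \<open>The potential of \<open>doob_potential_step\<close> has decreasing mean along the martingale: by
  \<open>norm_diff_ge_Re_cnj_sgn\<close> its increase is at most \<open>-4 Re (a\<^sub>0 (\<phi> \<circ> T) g)\<close>, where \<open>\<phi>\<close> is the product of
  the running maximum and the conjugate direction of the earlier sum, and this has mean zero because
  \<open>(\<phi> \<circ> T) g\<close> has integral zero.\<close>
lemma doob_potential_nonpos:
  assumes g: "orthogonal_to_pullbacks g"
  shows "(LINT x|M. 2 * (max_tail_sum g n a x)\<^sup>2
      - 4 * (max_tail_sum g n a x * norm (orbit_sum g n a x))) \<le> 0"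
proof (induction n arbitrary: a)
  case (Suc n)
  have g2: "square_integrable M g" using g by (simp add: orthogonal_to_pullbacks_def)
  define U where "U n a x = 2 * (max_tail_sum g n a x)\<^sup>2
      - 4 * (max_tail_sum g n a x * norm (orbit_sum g n a x))" for n a x
  define a' where "a' = (\<lambda>i. a (Suc i))"
  define \<phi> where "\<phi> x = of_real (max_tail_sum g n a' x) * cnj (sgn (orbit_sum g n a' x))" for x
  have U_int: "integrable M (U k b)" for k b
  proof -
    have m: "square_integrable M (\<lambda>x. of_real (max_tail_sum g k b x))"
      by (rule square_integrable_max_tail_sum[OF g2])
    have "integrable M (\<lambda>x. (max_tail_sum g k b x)\<^sup>2)"
      using m by (simp add: square_integrable_def)
    moreover have "integrable M (\<lambda>x. max_tail_sum g k b x * norm (orbit_sum g k b x))"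
      using integrable_norm[OF integrable_mult_square_integrable[OF m square_integrable_orbit_sum[OF g2, of k b]]]
      by (simp add: norm_mult max_tail_sum_nonneg)
    ultimately show ?thesis unfolding U_def by simp
  qed
  have \<phi>: "square_integrable M \<phi>"
  proof (rule square_integrable_bound[OF square_integrable_max_tail_sum[OF g2, of n a']])
    note [measurable] = borel_measurable_max_tail_sum[OF g2]
      square_integrable_measurable[OF square_integrable_orbit_sum[OF g2]]
    show "\<phi> \<in> borel_measurable M" unfolding \<phi>_def by measurable
    show "norm (\<phi> x) \<le> norm (complex_of_real (max_tail_sum g n a' x))" for x
      by (simp add: \<phi>_def norm_mult norm_sgn)
  qed
  have cross: "integrable M (\<lambda>x. a 0 * (\<phi> (T x) * g x))"
    by (intro integrable_mult_right integrable_mult_square_integrable square_integrable_compose_T \<phi> g2)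
  have cross0: "(LINT x|M. Re (a 0 * (\<phi> (T x) * g x))) = 0"
    unfolding integral_Re[OF cross]
    using g[unfolded orthogonal_to_pullbacks_def, THEN conjunct2, rule_format, OF \<phi>] by simp
  have cross_int: "integrable M (\<lambda>x. Re (a 0 * (\<phi> (T x) * g x)))"
    using cross by (rule integrable_Re)
  have step: "U (Suc n) a x \<le> U n a' (T x) - 4 * Re (a 0 * (\<phi> (T x) * g x))" for x
  proof -
    define m where "m = max_tail_sum g n a' (T x)"
    define z where "z = orbit_sum g n a' (T x)"
    define w where "w = a 0 * g x"
    have "m * Re (cnj (sgn z) * w) \<le> m * (norm (z + w) - norm z)"
      unfolding m_def by (intro mult_left_mono norm_diff_ge_Re_cnj_sgn max_tail_sum_nonneg)
    moreover have "m * Re (cnj (sgn z) * w) = Re (a 0 * (\<phi> (T x) * g x))"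
    proof -
      have "Re (a 0 * (\<phi> (T x) * g x)) = Re (of_real m * (cnj (sgn z) * w))"
        by (simp only: \<phi>_def m_def z_def w_def mult_ac)
      then show ?thesis by simp
    qed
    moreover have "U (Suc n) a x \<le> 2 * m\<^sup>2 - 4 * m * norm (z + w)"
      using doob_potential_step[of "norm (z + w)" m]
      by (simp add: U_def orbit_sum_Suc m_def z_def w_def a'_def add.commute mult.assoc)
    moreover have "U n a' (T x) = 2 * m\<^sup>2 - 4 * (m * norm z)"
      by (simp add: U_def m_def z_def)
    ultimately show ?thesis by (simp add: algebra_simps)
  qed
  have "(LINT x|M. U (Suc n) a x) \<le> (LINT x|M. U n a' (T x) - 4 * Re (a 0 * (\<phi> (T x) * g x)))"
    using U_int integrable_compose_T[OF U_int] cross_int step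
    by (intro integral_mono) (simp_all del: times_complex.sel)
  also have "\<dots> = (LINT x|M. U n a' (T x))"
    using integrable_compose_T[OF U_int] cross_int cross0
    by (simp del: times_complex.sel)
  also have "\<dots> = (LINT x|M. U n a' x)"
    using U_int by (intro integral_compose_T) auto
  also have "\<dots> \<le> 0" unfolding U_def by (rule Suc)
  finally show ?case unfolding U_def .
qed simp

text \<open>Doob's inequality bounds the second moment of the running maximum by four times that of the
  full sum; the first moment is what is kept, since it is additive when different \<open>g\<close> are combined.\<close>
lemma integral_max_tail_sum_le:
  assumes g: "orthogonal_to_pullbacks g"
  shows "(LINT x|M. max_tail_sum g n a x) \<le> 2 * sqrt (\<Sum>i<n. (norm (a i))\<^sup>2) * L2_norm M g"
proof -
  have g2: "square_integrable M g" using g by (simp add: orthogonal_to_pullbacks_def)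
  define m where "m x = complex_of_real (max_tail_sum g n a x)" for x
  have m: "square_integrable M m"
    unfolding m_def by (rule square_integrable_max_tail_sum[OF g2])
  note Q = square_integrable_orbit_sum[OF g2, of n a]
  have int: "integrable M (\<lambda>x. (max_tail_sum g n a x)\<^sup>2)"
      "integrable M (\<lambda>x. (norm (orbit_sum g n a x))\<^sup>2)"
    using m Q by (simp_all add: square_integrable_def m_def)
  have int': "integrable M (\<lambda>x. max_tail_sum g n a x * norm (orbit_sum g n a x))"
    using integrable_norm[OF integrable_mult_square_integrable[OF m Q]]
    by (simp add: norm_mult m_def max_tail_sum_nonneg)
  have "(LINT x|M. (max_tail_sum g n a x)\<^sup>2 - 4 * (norm (orbit_sum g n a x))\<^sup>2)
      \<le> (LINT x|M. 2 * (max_tail_sum g n a x)\<^sup>2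
        - 4 * (max_tail_sum g n a x * norm (orbit_sum g n a x)))"
  proof (rule integral_mono)
    show "(max_tail_sum g n a x)\<^sup>2 - 4 * (norm (orbit_sum g n a x))\<^sup>2
        \<le> 2 * (max_tail_sum g n a x)\<^sup>2 - 4 * (max_tail_sum g n a x * norm (orbit_sum g n a x))" for x
      using sum_squares_bound[of "max_tail_sum g n a x" "2 * norm (orbit_sum g n a x)"]
      by (simp add: power_mult_distrib)
  qed (use int int' in auto)
  also have "\<dots> \<le> 0" by (rule doob_potential_nonpos[OF g])
  finally have "(LINT x|M. (norm (m x))\<^sup>2) \<le> 4 * (LINT x|M. (norm (orbit_sum g n a x))\<^sup>2)"
    using int by (simp add: m_def)
  also have "\<dots> = 2\<^sup>2 * ((\<Sum>i<n. (norm (a i))\<^sup>2) * (LINT x|M. (norm (g x))\<^sup>2))"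
    by (simp add: integral_norm_square_orbit_sum[OF g])
  finally have "L2_norm M m \<le> sqrt (2\<^sup>2 * ((\<Sum>i<n. (norm (a i))\<^sup>2) * (LINT x|M. (norm (g x))\<^sup>2)))"
    unfolding L2_norm_def by (rule real_sqrt_le_mono)
  also have "\<dots> = 2 * sqrt (\<Sum>i<n. (norm (a i))\<^sup>2) * L2_norm M g"
    by (simp add: L2_norm_def real_sqrt_mult)
  finally show ?thesis
    using integral_norm_le_L2_norm[OF m] by (simp add: m_def max_tail_sum_nonneg)
qed

section \<open>Orbit sums of a general function\<close>
lemma integrable_compose_T_power:
  fixes g :: "'a \<Rightarrow> 'b::{banach, second_countable_topology}"
  assumes "integrable M g"
  shows "integrable M (\<lambda>x. g ((T ^^ k) x))"
  using assms
proof (induction k arbitrary: g)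
  case (Suc k)
  show ?case using Suc.IH[OF integrable_compose_T[OF Suc.prems]] by simp
qed simp

lemma integral_compose_T_power:
  fixes g :: "'a \<Rightarrow> 'b::{banach, second_countable_topology}"
  assumes "g \<in> borel_measurable M"
  shows "(LINT x|M. g ((T ^^ k) x)) = (LINT x|M. g x)"
  using assms
proof (induction k arbitrary: g)
  case (Suc k)
  show ?case
    using Suc.IH[of "\<lambda>x. g (T x)"] measurable_compose[OF T_measurable Suc.prems]
      integral_compose_T[OF Suc.prems] by simp
qed simp

lemma nn_integral_compose_T_power:
  assumes "g \<in> borel_measurable M"
  shows "(\<integral>\<^sup>+x. g ((T ^^ k) x) \<partial>M) = (\<integral>\<^sup>+x. g x \<partial>M)"
  using assms
proof (induction k arbitrary: g)
  case (Suc k)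
  show ?case
    using Suc.IH[of "\<lambda>x. g (T x)"] measurable_compose[OF T_measurable Suc.prems]
      nn_integral_compose_T[OF Suc.prems] by simp
qed simp

text \<open>The component of \<open>L\<^sup>k f\<close> orthogonal to the functions of \<open>T x\<close>. Composed with \<open>T\<^sup>k\<close> it is the difference of
  the conditional expectations of \<open>f\<close> given the pullbacks of the \<open>\<sigma>\<close>-algebra under \<open>T\<^sup>k\<close> and
  \<open>T\<^sup>k\<^sup>+\<^sup>1\<close>.\<close>
definition innovation :: "('a \<Rightarrow> complex) \<Rightarrow> nat \<Rightarrow> 'a \<Rightarrow> complex" where
  "innovation f k x = (transfer M T ^^ k) f x - (transfer M T ^^ Suc k) f (T x)"

lemma orthogonal_to_pullbacks_innovation:
  "square_integrable M f \<Longrightarrow> orthogonal_to_pullbacks (innovation f k)"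
  unfolding innovation_def[abs_def]
  using orthogonal_to_pullbacks_diff_transfer[OF square_integrable_transfer_power] by simp

lemma L2_norm_power2: "(L2_norm M g)\<^sup>2 = (LINT x|M. (norm (g x))\<^sup>2)"
  unfolding L2_norm_def by simp

lemma L2_norm_nonneg: "0 \<le> L2_norm M g"
  unfolding L2_norm_def by simp

lemma L2_norm_power2_innovation:
  assumes f: "square_integrable M f"
  shows "(L2_norm M (innovation f k))\<^sup>2
    = (L2_norm M ((transfer M T ^^ k) f))\<^sup>2 - (L2_norm M ((transfer M T ^^ Suc k) f))\<^sup>2"
  using integral_norm_square_add_pullback[OF orthogonal_to_pullbacks_innovation[OF f]
      square_integrable_transfer_power[OF f, of "Suc k"], of 1 k]
  by (simp add: L2_norm_power2 innovation_def)

lemma L2_norm_transfer_power_decreasing: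
  assumes f: "square_integrable M f"
  shows "L2_norm M ((transfer M T ^^ Suc k) f) \<le> L2_norm M ((transfer M T ^^ k) f)"
proof (rule power2_le_imp_le)
  show "(L2_norm M ((transfer M T ^^ Suc k) f))\<^sup>2 \<le> (L2_norm M ((transfer M T ^^ k) f))\<^sup>2"
    using L2_norm_power2_innovation[OF f, of k] zero_le_power2[of "L2_norm M (innovation f k)"] by linarith
qed (rule L2_norm_nonneg)

text \<open>Applying the telescoping identity \<open>f = (\<Sum>k<m. g\<^sub>k \<circ> T\<^sup>k) + (L\<^sup>m f) \<circ> T\<^sup>m\<close> along the orbit. It
  holds at every point and for finite \<open>m\<close>, which avoids any convergence question.\<close>
lemma orbit_sum_innovation_decomposition:
  "orbit_sum f n a x = (\<Sum>k<m. orbit_sum (innovation f k) n a ((T ^^ k) x))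
     + orbit_sum ((transfer M T ^^ m) f) n a ((T ^^ m) x)"
proof (induction m)
  case (Suc m)
  have "orbit_sum ((transfer M T ^^ m) f) n a y
      = orbit_sum (innovation f m) n a y + orbit_sum ((transfer M T ^^ Suc m) f) n a (T y)" for y
    by (simp add: orbit_sum_def innovation_def sum.distrib[symmetric] funpow_swap1 algebra_simps)
  from this[of "(T ^^ m) x"] Suc show ?case by simp
qed simp

text \<open>Each innovation contributes by the maximal inequality, and the remainder contributes at most
  \<open>(\<Sum>i<n. \<bar>a\<^sub>i\<bar>) \<parallel>L\<^sup>m f\<parallel>\<^sub>2\<close>. That factor is not controlled by the square sum of \<open>a\<close>, but \<open>n\<close> is
  fixed while \<open>m\<close> tends to infinity.\<close>
lemma nn_integral_max_orbit_sum_le: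
  assumes f: "square_integrable M f"
    and summable: "summable (\<lambda>k. L2_norm M (innovation f k))"
    and lim: "(\<lambda>k. L2_norm M ((transfer M T ^^ k) f)) \<longlonglongrightarrow> 0"
  shows "(\<integral>\<^sup>+x. (SUP j\<in>{..n}. ennreal (norm (orbit_sum f j a x))) \<partial>M)
    \<le> ennreal (4 * sqrt (\<Sum>i<n. (norm (a i))\<^sup>2) * (\<Sum>k. L2_norm M (innovation f k)))"
proof -
  define c where "c = sqrt (\<Sum>i<n. (norm (a i))\<^sup>2)"
  define D where "D k = L2_norm M (innovation f k)" for k
  define b where "b k = L2_norm M ((transfer M T ^^ k) f)" for k
  define A where "A = (\<Sum>i<n. norm (a i))"
  have c: "0 \<le> c" unfolding c_def by (intro real_sqrt_ge_zero sum_nonneg) simp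
  have bound: "(\<integral>\<^sup>+x. (SUP j\<in>{..n}. ennreal (norm (orbit_sum f j a x))) \<partial>M)
      \<le> ennreal (4 * c * (\<Sum>k. D k) + A * b m)" for m
  proof -
    define h where "h = (transfer M T ^^ m) f"
    define Y where "Y k x = 2 * max_tail_sum (innovation f k) n a ((T ^^ k) x)" for k x
    define R where "R x = (\<Sum>i<n. norm (a i) * norm (h ((T ^^ i) ((T ^^ m) x))))" for x
    have h: "square_integrable M h" unfolding h_def by (rule square_integrable_transfer_power[OF f])
    have g2: "square_integrable M (innovation f k)" for k
      using orthogonal_to_pullbacks_innovation[OF f] by (simp add: orthogonal_to_pullbacks_def)
    have max_int: "integrable M (max_tail_sum (innovation f k) n a)" for k
      using integrable_Re[OF square_integrable_imp_integrable[OF square_integrable_max_tail_sum[OF g2]]]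
      by simp
    have Y_int: "integrable M (Y k)" for k
      unfolding Y_def[abs_def] by (intro integrable_mult_right integrable_compose_T_power max_int)
    have h_int: "integrable M (\<lambda>x. norm (h x))"
      by (intro integrable_norm square_integrable_imp_integrable h)
    have hT_int: "integrable M (\<lambda>x. norm (h ((T ^^ i) ((T ^^ m) x))))" for i
      using integrable_compose_T_power[OF h_int, of "i + m"] by (simp add: funpow_add)
    have R_int: "integrable M R"
      unfolding R_def[abs_def] by (intro Bochner_Integration.integrable_sum integrable_mult_right hT_int)
    have Y_nonneg: "0 \<le> Y k x" for k x by (simp add: Y_def max_tail_sum_nonneg)
    have R_nonneg: "0 \<le> R x" for x by (auto simp: R_def intro!: sum_nonneg)
    have pointwise: "norm (orbit_sum f j a x) \<le> (\<Sum>k<m. Y k x) + R x" if "j \<le> n" for j x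
    proof -
      have "norm (orbit_sum h j a ((T ^^ m) x)) \<le> (\<Sum>i<j. norm (a i) * norm (h ((T ^^ i) ((T ^^ m) x))))"
        unfolding orbit_sum_def by (rule order_trans[OF norm_sum]) (simp add: norm_mult)
      also have "\<dots> \<le> R x"
        unfolding R_def using that by (intro sum_mono2) auto
      finally have "norm (orbit_sum h j a ((T ^^ m) x)) \<le> R x" .
      moreover have "norm (\<Sum>k<m. orbit_sum (innovation f k) j a ((T ^^ k) x)) \<le> (\<Sum>k<m. Y k x)"
        unfolding Y_def by (intro sum_norm_le norm_orbit_sum_le_max_tail_sum that)
      ultimately show ?thesis
        unfolding orbit_sum_innovation_decomposition[of f j a x m] h_def[symmetric]
        by (intro order_trans[OF norm_triangle_ineq] add_mono)
    qed
    have "(LINT x|M. Y k x) \<le> 4 * c * D k" for k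
    proof -
      have "(LINT x|M. Y k x) = 2 * (LINT x|M. max_tail_sum (innovation f k) n a x)"
        unfolding Y_def
        using integral_compose_T_power[OF borel_measurable_integrable[OF max_int], where k=k] by simp
      also have "\<dots> \<le> 2 * (2 * c * D k)"
        unfolding c_def D_def
        by (intro mult_left_mono integral_max_tail_sum_le orthogonal_to_pullbacks_innovation f) simp
      finally show ?thesis by simp
    qed
    then have "(\<Sum>k<m. LINT x|M. Y k x) \<le> (\<Sum>k<m. 4 * c * D k)"
      by (intro sum_mono)
    also have "\<dots> = 4 * c * (\<Sum>k<m. D k)" by (simp add: sum_distrib_left)
    also have "\<dots> \<le> 4 * c * (\<Sum>k. D k)"
      using c summable by (intro mult_left_mono sum_le_suminf) (auto simp: D_def L2_norm_nonneg)
    finally have Y_le: "(\<Sum>k<m. LINT x|M. Y k x) \<le> 4 * c * (\<Sum>k. D k)" .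
    have "(LINT x|M. R x) = (\<Sum>i<n. norm (a i) * (LINT x|M. norm (h ((T ^^ i) ((T ^^ m) x)))))"
      unfolding R_def using hT_int by simp
    also have "\<dots> = (\<Sum>i<n. norm (a i) * (LINT x|M. norm (h x)))"
    proof (intro sum.cong refl arg_cong2[where f="(*)"])
      show "(LINT x|M. norm (h ((T ^^ i) ((T ^^ m) x)))) = (LINT x|M. norm (h x))" for i
        using integral_compose_T_power[OF borel_measurable_integrable[OF h_int], of "i + m"]
        by (simp add: funpow_add)
    qed
    also have "\<dots> \<le> (\<Sum>i<n. norm (a i) * b m)"
      unfolding b_def h_def[symmetric] by (intro sum_mono mult_left_mono integral_norm_le_L2_norm h) simp
    also have "\<dots> = A * b m" by (simp add: A_def sum_distrib_right)
    finally have R_le: "(LINT x|M. R x) \<le> A * b m" .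
    have "(\<integral>\<^sup>+x. (SUP j\<in>{..n}. ennreal (norm (orbit_sum f j a x))) \<partial>M)
        \<le> (\<integral>\<^sup>+x. ennreal ((\<Sum>k<m. Y k x) + R x) \<partial>M)"
      by (intro nn_integral_mono SUP_least ennreal_leI pointwise) simp
    also have "\<dots> = ennreal (LINT x|M. (\<Sum>k<m. Y k x) + R x)"
      using Y_int R_int Y_nonneg R_nonneg
      by (intro nn_integral_eq_integral) (auto intro!: add_nonneg_nonneg sum_nonneg)
    also have "\<dots> \<le> ennreal (4 * c * (\<Sum>k. D k) + A * b m)"
      using Y_int R_int Y_le R_le by (intro ennreal_leI) simp
    finally show ?thesis .
  qed
  have "(\<lambda>m. ennreal (4 * c * (\<Sum>k. D k) + A * b m)) \<longlonglongrightarrow> ennreal (4 * c * (\<Sum>k. D k) + A * 0)"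
    unfolding b_def by (intro tendsto_intros tendsto_ennrealI lim)
  from LIMSEQ_le_const[OF this, of "\<integral>\<^sup>+x. (SUP j\<in>{..n}. ennreal (norm (orbit_sum f j a x))) \<partial>M"] bound
  show ?thesis unfolding c_def D_def by auto
qed

lemma nn_integral_sup_orbit_sum_le:
  assumes f: "square_integrable M f"
    and summable: "summable (\<lambda>k. L2_norm M (innovation f k))"
    and lim: "(\<lambda>k. L2_norm M ((transfer M T ^^ k) f)) \<longlonglongrightarrow> 0"
    and a: "summable (\<lambda>i. (norm (a i))\<^sup>2)"
  shows "(\<integral>\<^sup>+x. (SUP j. ennreal (norm (orbit_sum f j a x))) \<partial>M)
    \<le> ennreal (4 * sqrt (\<Sum>i. (norm (a i))\<^sup>2) * (\<Sum>k. L2_norm M (innovation f k)))"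
proof -
  let ?B = "\<lambda>n x. SUP j\<in>{..n}. ennreal (norm (orbit_sum f j a x))"
  note [measurable] = square_integrable_measurable[OF square_integrable_orbit_sum[OF f]]
  have "(SUP j. ennreal (norm (orbit_sum f j a x))) = (SUP n. ?B n x)" for x
    by (intro antisym SUP_least) (auto intro: SUP_upper2 SUP_upper)
  then have "(\<integral>\<^sup>+x. (SUP j. ennreal (norm (orbit_sum f j a x))) \<partial>M) = (\<integral>\<^sup>+x. (SUP n. ?B n x) \<partial>M)"
    by simp
  also have "\<dots> = (SUP n. \<integral>\<^sup>+x. ?B n x \<partial>M)"
  proof (rule nn_integral_monotone_convergence_SUP)
    show "incseq ?B" by (auto simp: incseq_def le_fun_def intro!: SUP_subset_mono)
  qed measurable
  also have "\<dots> \<le> ennreal (4 * sqrt (\<Sum>i. (norm (a i))\<^sup>2) * (\<Sum>k. L2_norm M (innovation f k)))"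
  proof (rule SUP_least)
    fix n
    have "(\<Sum>i<n. (norm (a i))\<^sup>2) \<le> (\<Sum>i. (norm (a i))\<^sup>2)"
      by (intro sum_le_suminf a) auto
    then have "4 * sqrt (\<Sum>i<n. (norm (a i))\<^sup>2) * (\<Sum>k. L2_norm M (innovation f k))
        \<le> 4 * sqrt (\<Sum>i. (norm (a i))\<^sup>2) * (\<Sum>k. L2_norm M (innovation f k))"
      using summable by (intro mult_right_mono suminf_nonneg) (auto simp: L2_norm_nonneg)
    with nn_integral_max_orbit_sum_le[OF f summable lim, where n=n and a=a]
    show "(\<integral>\<^sup>+x. ?B n x \<partial>M)
        \<le> ennreal (4 * sqrt (\<Sum>i. (norm (a i))\<^sup>2) * (\<Sum>k. L2_norm M (innovation f k)))"
      by (meson ennreal_leI order_trans)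
  qed
  finally show ?thesis .
qed

lemma orbit_sum_shift:
  "orbit_sum f n (\<lambda>i. a (i + p)) ((T ^^ p) x) = (\<Sum>i\<in>{p..<p + n}. a i * f ((T ^^ i) x))"
  unfolding orbit_sum_def lessThan_atLeast0
  using sum.shift_bounds_nat_ivl[of "\<lambda>i. a i * f ((T ^^ i) x)" 0 p n]
  by (simp add: funpow_add add.commute)

text \<open>Let \<open>W p\<close> be the supremum of the moduli of the blocks of the series that start at \<open>p\<close>. Its mean is
  at most a constant times the root of the square sum of \<open>a\<close> from \<open>p\<close> on, so \<open>INF p. W p x\<close> vanishes almost everywhere, and a
  single \<open>p\<close> with small \<open>W p x\<close> controls all later blocks.\<close>
lemma convergence_system_if_summable_innovations:
  assumes f: "square_integrable M f"
    and summable: "summable (\<lambda>k. L2_norm M (innovation f k))"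
    and lim: "(\<lambda>k. L2_norm M ((transfer M T ^^ k) f)) \<longlonglongrightarrow> 0"
  shows "convergence_system M (\<lambda>n x. f ((T ^^ n) x))"
  unfolding convergence_system_def
proof (intro allI impI)
  fix a :: "nat \<Rightarrow> complex"
  assume a: "summable (\<lambda>n. (norm (a n))\<^sup>2)"
  define W where "W p x = (SUP j. ennreal (norm (orbit_sum f j (\<lambda>i. a (i + p)) ((T ^^ p) x))))" for p x
  define S where "S = (\<Sum>k. L2_norm M (innovation f k))"
  note [measurable] = square_integrable_measurable[OF square_integrable_orbit_sum[OF f]]
    funpow_T_measurable
  have [measurable]: "W p \<in> borel_measurable M" for p unfolding W_def by measurable
  have W_le: "(\<integral>\<^sup>+x. W p x \<partial>M) \<le> ennreal (4 * sqrt (\<Sum>i. (norm (a (i + p)))\<^sup>2) * S)" for p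
  proof -
    have "(\<integral>\<^sup>+x. W p x \<partial>M) = (\<integral>\<^sup>+x. (SUP j. ennreal (norm (orbit_sum f j (\<lambda>i. a (i + p)) x))) \<partial>M)"
      unfolding W_def by (rule nn_integral_compose_T_power) measurable
    also have "\<dots> \<le> ennreal (4 * sqrt (\<Sum>i. (norm (a (i + p)))\<^sup>2) * S)"
      unfolding S_def using a
      by (intro nn_integral_sup_orbit_sum_le f summable lim) (subst summable_iff_shift)
    finally show ?thesis .
  qed
  have "(\<lambda>p. ennreal (4 * sqrt (\<Sum>i. (norm (a (i + p)))\<^sup>2) * S)) \<longlonglongrightarrow> ennreal (4 * sqrt 0 * S)"
    by (intro tendsto_intros tendsto_ennrealI suminf_exist_split2[OF a])
  moreover have "(\<integral>\<^sup>+x. (INF p. W p x) \<partial>M) \<le> ennreal (4 * sqrt (\<Sum>i. (norm (a (i + p)))\<^sup>2) * S)" for p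
    by (rule order_trans[OF _ W_le[of p]]) (intro nn_integral_mono INF_lower, simp)
  ultimately have "(\<integral>\<^sup>+x. (INF p. W p x) \<partial>M) \<le> ennreal (4 * sqrt 0 * S)"
    by (intro LIMSEQ_le_const) auto
  then have "(\<integral>\<^sup>+x. (INF p. W p x) \<partial>M) = 0" by simp
  then have "AE x in M. (INF p. W p x) = 0"
    by (subst (asm) nn_integral_0_iff_AE) measurable
  then show "AE x in M. summable (\<lambda>n. a n * f ((T ^^ n) x))"
  proof eventually_elim
    fix x assume x: "(INF p. W p x) = 0"
    show "summable (\<lambda>n. a n * f ((T ^^ n) x))"
      unfolding summable_Cauchy
    proof (intro allI impI)
      fix e :: real assume e: "0 < e"
      then have "(INF p. W p x) < ennreal (e / 2)" using x by simp
      then obtain p where p: "W p x < ennreal (e / 2)" by (auto simp: INF_less_iff)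
      have small: "norm (\<Sum>i\<in>{p..<n}. a i * f ((T ^^ i) x)) < e / 2" if "p \<le> n" for n
      proof -
        have "ennreal (norm (orbit_sum f (n - p) (\<lambda>i. a (i + p)) ((T ^^ p) x))) \<le> W p x"
          unfolding W_def by (rule SUP_upper) simp
        with p have "ennreal (norm (orbit_sum f (n - p) (\<lambda>i. a (i + p)) ((T ^^ p) x))) < ennreal (e / 2)"
          by (rule order_le_less_trans[rotated])
        then show ?thesis
          using that by (simp add: orbit_sum_shift ennreal_less_iff)
      qed
      have "norm (\<Sum>i\<in>{m..<n}. a i * f ((T ^^ i) x)) < e" if "p \<le> m" for m n
      proof (cases "m \<le> n")
        case True
        have "(\<Sum>i\<in>{m..<n}. a i * f ((T ^^ i) x))
            = (\<Sum>i\<in>{p..<n}. a i * f ((T ^^ i) x)) - (\<Sum>i\<in>{p..<m}. a i * f ((T ^^ i) x))"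
          using sum.atLeastLessThan_concat[OF that True, of "\<lambda>i. a i * f ((T ^^ i) x)"]
          by (simp add: algebra_simps)
        then show ?thesis
          using norm_triangle_ineq4[of "\<Sum>i\<in>{p..<n}. a i * f ((T ^^ i) x)"
              "\<Sum>i\<in>{p..<m}. a i * f ((T ^^ i) x)"] small[of n] small[of m] that True by simp
      qed (use e in simp)
      then show "\<exists>N. \<forall>m\<ge>N. \<forall>n. norm (\<Sum>i\<in>{m..<n}. a i * f ((T ^^ i) x)) < e" by blast
    qed
  qed
qed

end

theorem theoremE:
  fixes M :: "'a measure" and T :: "'a \<Rightarrow> 'a" and f :: "'a \<Rightarrow> complex"
  assumes "ergodic_system M T"
    and "square_integrable M f"
    and "AE x in M. (\<lambda>m. complex_cond_exp M (pullback_algebra M T m) f x) \<longlonglongrightarrow> 0"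
    and "summable (\<lambda>n. L2_norm M ((transfer M T ^^ Suc n) f) / sqrt (real (Suc n)))"
  shows "convergence_system M (\<lambda>n x. f ((T ^^ n) x))"
proof -
  interpret measure_preserving_system M T
    using assms(1) by (rule ergodic_system.axioms(1))
  note f = assms(2)
  \<comment> \<open>The weights start at the first power of the transfer operator, which shifts the sequence of
    norms by one against the innovations.\<close>
  define b where "b k = L2_norm M ((transfer M T ^^ Suc k) f)" for k
  have nonneg: "0 \<le> b k" and decr: "b (Suc k) \<le> b k" for k
    unfolding b_def by (rule L2_norm_nonneg, rule L2_norm_transfer_power_decreasing[OF f])
  have weighted: "summable (\<lambda>k. b k / sqrt (real (Suc k)))"
    using assms(4) by (simp add: b_def)
  have innovation_norm: "L2_norm M (innovation f (Suc k)) = sqrt ((b k)\<^sup>2 - (b (Suc k))\<^sup>2)" for k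
    unfolding b_def L2_norm_power2_innovation[OF f, symmetric] by (simp add: L2_norm_nonneg)
  have "summable (\<lambda>k. L2_norm M (innovation f (Suc k)))"
    unfolding innovation_norm by (rule summable_sqrt_square_decrements[OF nonneg decr weighted])
  then have "summable (\<lambda>k. L2_norm M (innovation f k))"
    by (subst (asm) summable_Suc_iff)
  moreover have "(\<lambda>k. L2_norm M ((transfer M T ^^ k) f)) \<longlonglongrightarrow> 0"
    using decreasing_tendsto_0_if_summable_over_sqrt[OF nonneg decr weighted]
    unfolding b_def by (rule LIMSEQ_imp_Suc)
  ultimately show ?thesis
    by (rule convergence_system_if_summable_innovations[OF f])
qed

end
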